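(* Suppose $\operatorname{rank}(C)=N_2$ and $|\operatorname{supp}(s_i)|=N_2$ for every $s_i\in\mathcal S$. Let $x_1^*$ be certified by Algorithm EPG-O, and let $\mathcal S_{\mathrm{val}}$ be the set returned by Algorithm EPG-V at $x_1^*$, run with $\varepsilon_{\mathrm{aud}}=0$ and with every audit and every recourse-dual linear program solved exactly (so that $\max_{s\in\mathcal S_{\mathrm{val}}}d(\xi,x_1^* )^\top s=\psi(x_1^*,\xi)$ for all $\xi\in\Xi$). For a fixed feature map $\Phi:\Xi\to\mathbb R^{N_{\mathrm{lift}}}$, the lifted policy class $\{\xi\mapsto Y\Phi(\xi): Y\in\mathbb R^{N_2\times N_{\mathrm{lift}}}\}$ contains a pointwise-optimal recourse rule at $x_1^*$ (i.e. some $Y\Phi(\cdot)$ such that for every $\xi\in\Xi$, $Y\Phi(\xi)$ is an optimal solution of $\min_{x_2}\{b^\top x_2\mid Cx_2\ge d(\xi,x_1^* )\}$) if and only if there exists a matrix $Y\in\mathbb R^{N_2\times N_{\mathrm{lift}}}$ such that, for every $\xi\in\Xi$, $$CY\Phi(\xi)\ge d(\xi,x_1^* ),\qquad b^\top Y\Phi(\xi)=\max_{s\in\mathcal S_{\mathrm{val}}}d(\xi,x_1^* )^\top s.$$ When such a matrix $Y$ exists, the lifted decision rule solves the full master problem exactly, i.e. $x_1^*$ together with the recourse policy $x_2(\xi)=Y\Phi(\xi)$ is feasible and attains the optimal value of the full master problem: $c^\top x_1^*+\sup_{\mathbb P\in\mathcal P}\mathbb E_{\mathbb P}[b^\top Y\Phi(\xi)]$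 equals that value.
   Context: Setting. $\Xi\subseteq\mathbb R^{N_\xi}$ is a compact uncertainty set, $\mathcal P$ is a set of probability measures supported on $\Xi$ (the ambiguity set), $C\in\mathbb R^{M\times N_2}$ with $M\ge N_2$, $b\in\mathbb R^{N_2}$, and $B,W,w,A,a,c$ are fixed data of compatible dimensions; $x_1\in\mathbb R^{N_1}$, $x_2\in\mathbb R^{N_2}$. Put $d(\xi,x_1)=W\xi+w-Bx_1\in\mathbb R^M$. The recourse value is $\psi(x_1,\xi)=\min_{x_2}\{b^\top x_2\mid Cx_2\ge d(\xi,x_1)\}$ ($+\infty$ if infeasible). The dual polyhedron $\mathcal Z=\{z\in\mathbb R^M\mid C^\top z=b,\ z\ge 0\}$ is assumed nonempty; $\mathcal S=\{s_1,\dots,s_S\}$ is its finite set of extreme points (vertices), and $\mathcal R$ is the finite set of extreme rays of its recession cone. The first-stage feasible region is $$\mathcal X_1=\{x_1: Ax_1\ge a,\ \sup_{\xi\in\Xi}d(\xi,x_1)^\top r\le 0\ \ \forall r\in\mathcal R\}.$$ $\Theta\subseteq\mathbb R^{N_\theta}$, $\phi_0:\Theta\to\mathbb R$ and $\phi_\ell:\Theta\times\Xi\to\mathbb R$ ($\ell\in[L]$) are determined by $\mathcal P$. The full master problem is $$\min_{x_1\in\mathcal X_1,\theta\in\Theta}\ c^\top x_1+\phi_0(\theta)\quad\text{s.t.}\quad \phi_\ell(\theta,\xi)\ge d(\xi,x_1)^\top s\ \ \forall\xi\in\Xi,\ s\in\mathcal S,\ \ell\in[L].$$ Standing assumptions: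 the two-stage distributionally robust problem $\min_{x_1:Ax_1\ge a}c^\top x_1+\sup_{\mathbb P\in\mathcal P}\mathbb E_{\mathbb P}[\psi(x_1,\xi)]$ has a finite, attained optimal value, and the full master problem is an exact reformulation of it (same optimal value and same optimal first-stage decisions). $\operatorname{supp}(v)$ is the index set of nonzero components; $v_{\mathcal J}$ and $C_{\mathcal J}$ are the subvector and row submatrix indexed by $\mathcal J$; $C_k$ is the $k$-th row of $C$. Algorithm EPG-O. The RMP for $\mathcal S_t\subseteq\mathcal S$ is the full master with $\mathcal S$ replaced by $\mathcal S_t$. Exact separation at $(x_1^{(t)},\theta^{(t)})$ computes $V^{(t)}=\max_{\ell\in[L]}\max_{\xi\in\Xi,z\in\mathcal Z}[d(\xi,x_1^{(t)})^\top z-\phi_\ell(\theta^{(t)},\xi)]$; approximate separation computes $V'^{(t)}$ by the same formula with $\Xi$ replaced by a finite set $\Xi^{(t)}\subseteq\Xi$ of candidate worst-case scenarios from the current RMP. Input: a nonempty seed $\mathcal S_1\subseteq\mathcal S$ and tolerances $\varepsilon_{\mathrm{disc}},\varepsilon_{\mathrm{obj}}\ge0$. Starting from $t=1$, repeat: solve the RMP for $\mathcal S_t$ to get $(x_1^{(t)},\theta^{(t)})$; solve approximate separation, obtaining a maximizing vertex $\hat s^{(t)}$; if $V'^{(t)}>\varepsilon_{\mathrm{disc}}$ set $s^\star=\hat s^{(t)}$; otherwise solve exact separation, obtaining a maximizing vertex $s^\star$, and if $V^{(t)}\le\varepsilon_{\mathrm{obj}}$, delete vertices from $\mathcal S_t$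 until no further deletion preserves the RMP value, giving $\mathcal S_{\mathrm{obj}}$, return $(x_1^{(t)},\theta^{(t)},\mathcal S_{\mathrm{obj}})$ and stop; finally set $\mathcal S_{t+1}=\mathcal S_t\cup\{s^\star\}$, $t\leftarrow t+1$. "Certified by EPG-O" means returned as the $x_1$-component of the output with $\varepsilon_{\mathrm{obj}}=0$ and all problems solved exactly, so that $(x_1^*,\theta^* )$ is optimal for the full master problem for some $\theta^*$. Algorithm EPG-V (at the fixed decision $x_1^*$). For $s_i\in\mathcal S$ let $\mathcal J_i=\operatorname{supp}(s_i)$ and $x_{2,i}(\xi)=C_{\mathcal J_i}^{-1}d_{\mathcal J_i}(\xi,x_1^* )$. For nonempty $\mathcal T\subseteq\mathcal S$ and $s_i\in\mathcal T$, the dominance cell is $$\widehat{\mathcal R}_i(\mathcal T)=\{\xi\in\Xi:\ d(\xi,x_1^* )^\top s_i\ge d(\xi,x_1^* )^\top s_j\ \ \forall s_j\in\mathcal T\},$$ and for each nonempty cell and each $k\in[M]\setminus\mathcal J_i$ the audit is $$\Delta_{ik}(\mathcal T)=\max_{\xi\in\widehat{\mathcal R}_i(\mathcal T)}\{d_k(\xi,x_1^* )-C_kx_{2,i}(\xi)\}.$$ Input: $x_1^*$, a nonempty EPG-O output set $\mathcal S'\subseteq\mathcal S$, and $\varepsilon_{\mathrm{aud}}\ge0$. Initialize $\mathcal S_{\mathrm{val}}=\mathcal S'$ and solve all audits for nonempty cells. While some $\Delta_{ik}(\mathcal S_{\mathrm{val}})>\varepsilon_{\mathrm{aud}}$: choose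 such a pair $(i,k)$ and a maximizing witness $\hat\xi\in\widehat{\mathcal R}_i(\mathcal S_{\mathrm{val}})$; solve the recourse-dual linear program $\max_{z\in\mathcal Z}d(\hat\xi,x_1^* )^\top z$ to obtain an optimal extreme point $s^{\mathrm{new}}\in\mathcal S$; replace $\mathcal S_{\mathrm{val}}$ by $\mathcal S_{\mathrm{val}}\cup\{s^{\mathrm{new}}\}$; recompute all nonempty cells and audits. After the loop, prune $\mathcal S_{\mathrm{val}}$ by deleting the extreme points whose dominance cell $\widehat{\mathcal R}_i(\mathcal S_{\mathrm{val}})$ has empty relative interior in $\Xi$ (empty interior in the subspace topology of $\Xi$), and return $\mathcal S_{\mathrm{val}}$. *)

theory Defs
  imports "HOL-Probability.Probability"
begin

text \<open>
  All dimensions, and the index set of the functions \<open>phi D l\<close>, are finite types: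
  \<open>'x\<close> (uncertainty), \<open>'m\<close> (second-stage constraints), \<open>'n\<close> (second-stage decision),
  \<open>'f\<close> (first-stage decision), \<open>'p\<close> (first-stage constraints), \<open>'t\<close> (master variable
  \<open>\<theta>\<close>), \<open>'l\<close> (index \<open>\<ell>\<close>).
\<close>

record ('x::finite, 'm::finite, 'n::finite, 'f::finite, 'p::finite, 't::finite, 'l::finite)
    two_stage =
  Xi :: "(real ^ 'x) set"
  Amb :: "(real ^ 'x) measure set"
  Cmat :: "real ^ 'n ^ 'm"
  bvec :: "real ^ 'n"
  Bmat :: "real ^ 'f ^ 'm"
  Wmat :: "real ^ 'x ^ 'm"
  wvec :: "real ^ 'm"
  Amat :: "real ^ 'f ^ 'p"
  avec :: "real ^ 'p"
  cvec :: "real ^ 'f"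
  Theta :: "(real ^ 't) set"
  phi0 :: "real ^ 't \<Rightarrow> real"
  phi :: "'l \<Rightarrow> real ^ 't \<Rightarrow> real ^ 'x \<Rightarrow> real"


section \<open>The two-stage problem\<close>

text \<open>The order \<open>\<le>\<close> on \<open>real ^ 'k\<close> is the componentwise one.\<close>

definition dvec ::
  "('x::finite, 'm::finite, 'n::finite, 'f::finite, 'p::finite, 't::finite, 'l::finite) two_stage
    \<Rightarrow> real ^ 'f \<Rightarrow> real ^ 'x \<Rightarrow> real ^ 'm" where
  "dvec D x1 \<xi> = Wmat D *v \<xi> + wvec D - Bmat D *v x1"

definition recourse_feasible ::
  "('x::finite, 'm::finite, 'n::finite, 'f::finite, 'p::finite, 't::finite, 'l::finite) two_stage
    \<Rightarrow> real ^ 'f \<Rightarrow> real ^ 'x \<Rightarrow> real ^ 'n \<Rightarrow> bool" where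
  "recourse_feasible D x1 \<xi> x2 \<longleftrightarrow> dvec D x1 \<xi> \<le> Cmat D *v x2"

definition recourse_optimal ::
  "('x::finite, 'm::finite, 'n::finite, 'f::finite, 'p::finite, 't::finite, 'l::finite) two_stage
    \<Rightarrow> real ^ 'f \<Rightarrow> real ^ 'x \<Rightarrow> real ^ 'n \<Rightarrow> bool" where
  "recourse_optimal D x1 \<xi> x2 \<longleftrightarrow>
     is_arg_min (\<lambda>y. bvec D \<bullet> y) (recourse_feasible D x1 \<xi>) x2"

definition psi ::
  "('x::finite, 'm::finite, 'n::finite, 'f::finite, 'p::finite, 't::finite, 'l::finite) two_stage
    \<Rightarrow> real ^ 'f \<Rightarrow> real ^ 'x \<Rightarrow> ereal" where
  "psi D x1 \<xi> = (INF x2\<in>{x2. recourse_feasible D x1 \<xi> x2}. ereal (bvec D \<bullet> x2))"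

text \<open>
  Expectation of an extended-real function, as the difference of the integrals of its positive
  and negative parts (\<open>e2ennreal\<close> truncates negative values to 0).  The measures considered are
  concentrated on \<open>\<Xi>\<close> and the integrands are meaningful only there, so the integrals are taken
  over \<open>\<Xi>\<close>.  The integrands in use are bounded below on \<open>\<Xi>\<close>, so
  \<open>\<infinity> - \<infinity>\<close> does not arise.
\<close>

definition expect ::
  "('x::finite, 'm::finite, 'n::finite, 'f::finite, 'p::finite, 't::finite, 'l::finite) two_stage
    \<Rightarrow> (real ^ 'x) measure \<Rightarrow> (real ^ 'x \<Rightarrow> ereal) \<Rightarrow> ereal" where
  "expect D P g =
     enn2ereal (\<integral>\<^sup>+ \<xi>. e2ennreal (g \<xi>) * indicator (Xi D) \<xi> \<partial>P)
   - enn2ereal (\<integral>\<^sup>+ \<xi>. e2ennreal (- g \<xi>) * indicator (Xi D) \<xi> \<partial>P)"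

definition worst_case ::
  "('x::finite, 'm::finite, 'n::finite, 'f::finite, 'p::finite, 't::finite, 'l::finite) two_stage
    \<Rightarrow> (real ^ 'x \<Rightarrow> ereal) \<Rightarrow> ereal" where
  "worst_case D g = (SUP P\<in>Amb D. expect D P g)"

definition dro_objective ::
  "('x::finite, 'm::finite, 'n::finite, 'f::finite, 'p::finite, 't::finite, 'l::finite) two_stage
    \<Rightarrow> real ^ 'f \<Rightarrow> ereal" where
  "dro_objective D x1 = ereal (cvec D \<bullet> x1) + worst_case D (psi D x1)"

definition dro_value ::
  "('x::finite, 'm::finite, 'n::finite, 'f::finite, 'p::finite, 't::finite, 'l::finite) two_stage
    \<Rightarrow> ereal" where
  "dro_value D = (INF x1\<in>{x1. avec D \<le> Amat D *v x1}. dro_objective D x1)"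

definition dro_optimal ::
  "('x::finite, 'm::finite, 'n::finite, 'f::finite, 'p::finite, 't::finite, 'l::finite) two_stage
    \<Rightarrow> real ^ 'f \<Rightarrow> bool" where
  "dro_optimal D x1 \<longleftrightarrow> avec D \<le> Amat D *v x1 \<and> dro_objective D x1 = dro_value D"


section \<open>Dual polyhedron and master problems\<close>

definition dual_poly ::
  "('x::finite, 'm::finite, 'n::finite, 'f::finite, 'p::finite, 't::finite, 'l::finite) two_stage
    \<Rightarrow> (real ^ 'm) set" where
  "dual_poly D = {z. transpose (Cmat D) *v z = bvec D \<and> 0 \<le> z}"

definition vertices ::
  "('x::finite, 'm::finite, 'n::finite, 'f::finite, 'p::finite, 't::finite, 'l::finite) two_stage
    \<Rightarrow> (real ^ 'm) set" where
  "vertices D = {s. s extreme_point_of dual_poly D}"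

definition recession_cone :: "'a::real_vector set \<Rightarrow> 'a set" where
  "recession_cone Z = {r. \<forall>z\<in>Z. \<forall>t\<ge>0. z + t *\<^sub>R r \<in> Z}"

text \<open>Every extreme ray (one-dimensional face that is a half-line) of the recession cone is
  represented by its unit vector, so that this set is finite.\<close>

definition extreme_rays ::
  "('x::finite, 'm::finite, 'n::finite, 'f::finite, 'p::finite, 't::finite, 'l::finite) two_stage
    \<Rightarrow> (real ^ 'm) set" where
  "extreme_rays D =
     {r. norm r = 1 \<and> {t *\<^sub>R r | t. 0 \<le> t} face_of recession_cone (dual_poly D)}"

definition X1 ::
  "('x::finite, 'm::finite, 'n::finite, 'f::finite, 'p::finite, 't::finite, 'l::finite) two_stage
    \<Rightarrow> (real ^ 'f) set" where
  "X1 D = {x1. avec D \<le> Amat D *v x1 \<and>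
               (\<forall>r\<in>extreme_rays D. (SUP \<xi>\<in>Xi D. ereal (dvec D x1 \<xi> \<bullet> r)) \<le> 0)}"

text \<open>The restricted master problem for a set \<open>T\<close> of vertices; the full master problem is the
  case \<open>T = vertices D\<close>.\<close>

definition master_feasible ::
  "('x::finite, 'm::finite, 'n::finite, 'f::finite, 'p::finite, 't::finite, 'l::finite) two_stage
    \<Rightarrow> (real ^ 'm) set \<Rightarrow> (real ^ 'f) \<times> (real ^ 't) \<Rightarrow> bool" where
  "master_feasible D T = (\<lambda>(x1, \<theta>). x1 \<in> X1 D \<and> \<theta> \<in> Theta D \<and>
     (\<forall>\<xi>\<in>Xi D. \<forall>s\<in>T. \<forall>l. phi D l \<theta> \<xi> \<ge> dvec D x1 \<xi> \<bullet> s))"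

definition master_objective ::
  "('x::finite, 'm::finite, 'n::finite, 'f::finite, 'p::finite, 't::finite, 'l::finite) two_stage
    \<Rightarrow> (real ^ 'f) \<times> (real ^ 't) \<Rightarrow> real" where
  "master_objective D = (\<lambda>(x1, \<theta>). cvec D \<bullet> x1 + phi0 D \<theta>)"

definition master_optimal ::
  "('x::finite, 'm::finite, 'n::finite, 'f::finite, 'p::finite, 't::finite, 'l::finite) two_stage
    \<Rightarrow> (real ^ 'm) set \<Rightarrow> (real ^ 'f) \<times> (real ^ 't) \<Rightarrow> bool" where
  "master_optimal D T = is_arg_min (master_objective D) (master_feasible D T)"

definition master_value ::
  "('x::finite, 'm::finite, 'n::finite, 'f::finite, 'p::finite, 't::finite, 'l::finite) two_stage
    \<Rightarrow> (real ^ 'm) set \<Rightarrow> ereal" where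
  "master_value D T = (INF v\<in>{v. master_feasible D T v}. ereal (master_objective D v))"

text \<open>The last three conjuncts: the distributionally robust problem has a finite optimal value
  and attains it, and the full master problem is an exact reformulation of it.\<close>

definition standing_assumptions ::
  "('x::finite, 'm::finite, 'n::finite, 'f::finite, 'p::finite, 't::finite, 'l::finite) two_stage
    \<Rightarrow> bool" where
  "standing_assumptions D \<longleftrightarrow>
     compact (Xi D) \<and>
     (\<forall>P\<in>Amb D. prob_space P \<and> sets P = sets borel \<and> emeasure P (Xi D) = 1) \<and>
     CARD('n) \<le> CARD('m) \<and>
     dual_poly D \<noteq> {} \<and>
     (\<bar>dro_value D\<bar> \<noteq> \<infinity> \<and> (\<exists>x1. dro_optimal D x1)) \<and>
     master_value D (vertices D) = dro_value D \<and>
     (\<forall>x1. (\<exists>\<theta>. master_optimal D (vertices D) (x1, \<theta>)) \<longleftrightarrow> dro_optimal D x1)"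


section \<open>Algorithm EPG-O\<close>

text \<open>\<open>V\<close> is the optimal value of the separation problem over the scenario set \<open>\<Xi>'\<close> at
  \<open>(x1, \<theta>)\<close>, attained at the vertex \<open>s\<close>.  The maximum has to be attained, so \<open>\<Xi>'\<close> is
  nonempty.\<close>

definition separation ::
  "('x::finite, 'm::finite, 'n::finite, 'f::finite, 'p::finite, 't::finite, 'l::finite) two_stage
    \<Rightarrow> (real ^ 'x) set \<Rightarrow> (real ^ 'f) \<times> (real ^ 't) \<Rightarrow> real \<Rightarrow> real ^ 'm \<Rightarrow> bool" where
  "separation D \<Xi>' = (\<lambda>(x1, \<theta>) V s.
     s \<in> vertices D \<and>
     (\<exists>l. \<exists>\<xi>\<in>\<Xi>'. V = dvec D x1 \<xi> \<bullet> s - phi D l \<theta> \<xi>) \<and>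
     (\<forall>l. \<forall>\<xi>\<in>\<Xi>'. \<forall>z\<in>dual_poly D. dvec D x1 \<xi> \<bullet> z - phi D l \<theta> \<xi> \<le> V))"

text \<open>\<open>epgo_reaches D S1 \<epsilon>disc \<epsilon>obj T\<close>: some run from the seed \<open>S1\<close> reaches an iteration whose
  restricted master problem is the one for \<open>T\<close>.  All choices left open by the algorithm (optimal
  solutions, candidate scenarios, maximizing vertices) are nondeterministic.\<close>

inductive epgo_reaches ::
  "('x::finite, 'm::finite, 'n::finite, 'f::finite, 'p::finite, 't::finite, 'l::finite) two_stage
    \<Rightarrow> (real ^ 'm) set \<Rightarrow> real \<Rightarrow> real \<Rightarrow> (real ^ 'm) set \<Rightarrow> bool"
  for D S1 \<epsilon>disc \<epsilon>obj where
  seed: "S1 \<noteq> {} \<Longrightarrow> S1 \<subseteq> vertices D \<Longrightarrow> epgo_reaches D S1 \<epsilon>disc \<epsilon>obj S1"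
| approx: "epgo_reaches D S1 \<epsilon>disc \<epsilon>obj T \<Longrightarrow> master_optimal D T v \<Longrightarrow>
     finite \<Xi>' \<Longrightarrow> \<Xi>' \<subseteq> Xi D \<Longrightarrow> separation D \<Xi>' v V' s' \<Longrightarrow> V' > \<epsilon>disc \<Longrightarrow>
     epgo_reaches D S1 \<epsilon>disc \<epsilon>obj (insert s' T)"
| exact: "epgo_reaches D S1 \<epsilon>disc \<epsilon>obj T \<Longrightarrow> master_optimal D T v \<Longrightarrow>
     finite \<Xi>' \<Longrightarrow> \<Xi>' \<subseteq> Xi D \<Longrightarrow> separation D \<Xi>' v V' s' \<Longrightarrow> V' \<le> \<epsilon>disc \<Longrightarrow>
     separation D (Xi D) v V s \<Longrightarrow> V > \<epsilon>obj \<Longrightarrow>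
     epgo_reaches D S1 \<epsilon>disc \<epsilon>obj (insert s T)"

definition delete_vertex ::
  "('x::finite, 'm::finite, 'n::finite, 'f::finite, 'p::finite, 't::finite, 'l::finite) two_stage
    \<Rightarrow> (real ^ 'm) set \<Rightarrow> (real ^ 'm) set \<Rightarrow> bool" where
  "delete_vertex D T T' \<longleftrightarrow> (\<exists>s\<in>T. T' = T - {s} \<and> master_value D T' = master_value D T)"

definition epgo_returns ::
  "('x::finite, 'm::finite, 'n::finite, 'f::finite, 'p::finite, 't::finite, 'l::finite) two_stage
    \<Rightarrow> (real ^ 'm) set \<Rightarrow> real \<Rightarrow> real \<Rightarrow> real ^ 'f \<Rightarrow> real ^ 't \<Rightarrow> (real ^ 'm) set \<Rightarrow> bool" where
  "epgo_returns D S1 \<epsilon>disc \<epsilon>obj x1 \<theta> Sobj \<longleftrightarrow>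
     \<epsilon>disc \<ge> 0 \<and> \<epsilon>obj \<ge> 0 \<and>
     (\<exists>T \<Xi>' V' s' V s.
        epgo_reaches D S1 \<epsilon>disc \<epsilon>obj T \<and> master_optimal D T (x1, \<theta>) \<and>
        finite \<Xi>' \<and> \<Xi>' \<subseteq> Xi D \<and> separation D \<Xi>' (x1, \<theta>) V' s' \<and> V' \<le> \<epsilon>disc \<and>
        separation D (Xi D) (x1, \<theta>) V s \<and> V \<le> \<epsilon>obj \<and>
        (delete_vertex D)\<^sup>*\<^sup>* T Sobj \<and> (\<nexists>T'. delete_vertex D Sobj T'))"

definition epgo_certified ::
  "('x::finite, 'm::finite, 'n::finite, 'f::finite, 'p::finite, 't::finite, 'l::finite) two_stage
    \<Rightarrow> real ^ 'f \<Rightarrow> bool" where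
  "epgo_certified D x1 \<longleftrightarrow> (\<exists>S1 \<epsilon>disc \<theta> Sobj. epgo_returns D S1 \<epsilon>disc 0 x1 \<theta> Sobj)"

definition epgo_output_set ::
  "('x::finite, 'm::finite, 'n::finite, 'f::finite, 'p::finite, 't::finite, 'l::finite) two_stage
    \<Rightarrow> (real ^ 'm) set \<Rightarrow> bool" where
  "epgo_output_set D S' \<longleftrightarrow>
     (\<exists>S1 \<epsilon>disc \<epsilon>obj x1 \<theta>. epgo_returns D S1 \<epsilon>disc \<epsilon>obj x1 \<theta> S')"


section \<open>Algorithm EPG-V\<close>

definition supp :: "real ^ 'm::finite \<Rightarrow> 'm set" where
  "supp v = {i. v $ i \<noteq> 0}"

text \<open>For an index set \<open>J\<close> with \<open>card J = CARD('n)\<close>, the rows of \<open>sub_rows J C\<close> and the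
  entries of \<open>sub_vec J v\<close> are numbered by \<open>'n\<close> through one fixed bijection onto \<open>J\<close>, which
  makes the submatrix square.  The product \<open>matrix_inv (sub_rows J C) *v sub_vec J v\<close> does not
  depend on that bijection.\<close>

definition enum_of :: "'m::finite set \<Rightarrow> 'n::finite \<Rightarrow> 'm" where
  "enum_of J = (SOME e. bij_betw e UNIV J)"

definition sub_rows :: "'m::finite set \<Rightarrow> real ^ 'n ^ 'm \<Rightarrow> real ^ 'n ^ 'n::finite" where
  "sub_rows J C = (\<chi> i. C $ enum_of J i)"

definition sub_vec :: "'m::finite set \<Rightarrow> real ^ 'm \<Rightarrow> real ^ 'n::finite" where
  "sub_vec J v = (\<chi> i. v $ enum_of J i)"

definition basic_rule ::
  "('x::finite, 'm::finite, 'n::finite, 'f::finite, 'p::finite, 't::finite, 'l::finite) two_stage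
    \<Rightarrow> real ^ 'f \<Rightarrow> real ^ 'm \<Rightarrow> real ^ 'x \<Rightarrow> real ^ 'n" where
  "basic_rule D x1 s \<xi> = matrix_inv (sub_rows (supp s) (Cmat D)) *v sub_vec (supp s) (dvec D x1 \<xi>)"

definition cell ::
  "('x::finite, 'm::finite, 'n::finite, 'f::finite, 'p::finite, 't::finite, 'l::finite) two_stage
    \<Rightarrow> real ^ 'f \<Rightarrow> (real ^ 'm) set \<Rightarrow> real ^ 'm \<Rightarrow> (real ^ 'x) set" where
  "cell D x1 T s = {\<xi>\<in>Xi D. \<forall>s'\<in>T. dvec D x1 \<xi> \<bullet> s \<ge> dvec D x1 \<xi> \<bullet> s'}"

definition violation ::
  "('x::finite, 'm::finite, 'n::finite, 'f::finite, 'p::finite, 't::finite, 'l::finite) two_stage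
    \<Rightarrow> real ^ 'f \<Rightarrow> real ^ 'm \<Rightarrow> 'm \<Rightarrow> real ^ 'x \<Rightarrow> real" where
  "violation D x1 s k \<xi> = dvec D x1 \<xi> $ k - (Cmat D *v basic_rule D x1 s \<xi>) $ k"

text \<open>On a nonempty cell (which is compact when \<open>\<Xi>\<close> is) this supremum is a maximum.\<close>

definition audit ::
  "('x::finite, 'm::finite, 'n::finite, 'f::finite, 'p::finite, 't::finite, 'l::finite) two_stage
    \<Rightarrow> real ^ 'f \<Rightarrow> (real ^ 'm) set \<Rightarrow> real ^ 'm \<Rightarrow> 'm \<Rightarrow> real" where
  "audit D x1 T s k = (SUP \<xi>\<in>cell D x1 T s. violation D x1 s k \<xi>)"

definition audit_pair ::
  "('x::finite, 'm::finite, 'n::finite, 'f::finite, 'p::finite, 't::finite, 'l::finite) two_stage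
    \<Rightarrow> real ^ 'f \<Rightarrow> (real ^ 'm) set \<Rightarrow> real ^ 'm \<Rightarrow> 'm \<Rightarrow> bool" where
  "audit_pair D x1 T s k \<longleftrightarrow> s \<in> T \<and> cell D x1 T s \<noteq> {} \<and> k \<notin> supp s"

inductive epgv_reaches ::
  "('x::finite, 'm::finite, 'n::finite, 'f::finite, 'p::finite, 't::finite, 'l::finite) two_stage
    \<Rightarrow> real ^ 'f \<Rightarrow> (real ^ 'm) set \<Rightarrow> real \<Rightarrow> (real ^ 'm) set \<Rightarrow> bool"
  for D x1 S' \<epsilon>aud where
  init: "epgv_reaches D x1 S' \<epsilon>aud S'"
| augment: "epgv_reaches D x1 S' \<epsilon>aud T \<Longrightarrow>
     audit_pair D x1 T s k \<Longrightarrow> audit D x1 T s k > \<epsilon>aud \<Longrightarrow>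
     \<xi> \<in> cell D x1 T s \<Longrightarrow> violation D x1 s k \<xi> = audit D x1 T s k \<Longrightarrow>
     snew \<in> vertices D \<Longrightarrow> is_arg_max (\<lambda>z. dvec D x1 \<xi> \<bullet> z) (\<lambda>z. z \<in> dual_poly D) snew \<Longrightarrow>
     epgv_reaches D x1 S' \<epsilon>aud (insert snew T)"

definition epgv_returns ::
  "('x::finite, 'm::finite, 'n::finite, 'f::finite, 'p::finite, 't::finite, 'l::finite) two_stage
    \<Rightarrow> real ^ 'f \<Rightarrow> (real ^ 'm) set \<Rightarrow> real \<Rightarrow> (real ^ 'm) set \<Rightarrow> bool" where
  "epgv_returns D x1 S' \<epsilon>aud Sval \<longleftrightarrow>
     S' \<noteq> {} \<and> epgo_output_set D S' \<and> \<epsilon>aud \<ge> 0 \<and>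
     (\<exists>T. epgv_reaches D x1 S' \<epsilon>aud T \<and>
          (\<forall>s k. audit_pair D x1 T s k \<longrightarrow> audit D x1 T s k \<le> \<epsilon>aud) \<and>
          Sval = {s\<in>T. top_of_set (Xi D) interior_of cell D x1 T s \<noteq> {}})"


section \<open>Lifted policies\<close>

definition lifted_policies ::
  "(real ^ 'x::finite \<Rightarrow> real ^ 'k::finite) \<Rightarrow> (real ^ 'x \<Rightarrow> real ^ 'n::finite) set" where
  "lifted_policies \<Phi> = {(\<lambda>\<xi>. Y *v \<Phi> \<xi>) | Y. True}"

end

theory Submission
  imports Defs
begin

text \<open>
  Two certificates carry the theorem.

  The first concerns the first-stage decision.  A run of EPG-O with zero tolerance stops only when
  exact separation finds no violated pair of a scenario and a dual point, so the optimum of the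
  restricted master problem is feasible, hence optimal, for the full one
  (\<open>epgo_certified_master_optimal\<close>).  By the exact-reformulation assumption the decision \<open>x1\<close> is
  then optimal for the distributionally robust problem.

  The second concerns the recourse.  At a vertex \<open>s\<close> of the dual polyhedron with as many nonzero
  entries as the recourse has variables, the rows of \<open>C\<close> indexed by the support form an invertible
  matrix: a linear dependence among them would give a direction along which \<open>s\<close> can be moved both
  ways inside the polyhedron (\<open>vertex_kernel_trivial\<close>).  The basic rule therefore meets the supported
  constraints with equality, so it is complementary to \<open>s\<close>.  When no audit is positive it also meets
  the other constraints on the dominance cell of \<open>s\<close>; linear programming duality then makes both the
  rule and \<open>s\<close> optimal there.  As the cells cover the uncertainty set, the largest dual value among
  the collected vertices is the recourse value (\<open>audited_vertices_attain_psi\<close>).  The final pruning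
  does no harm: the cells are finitely many closed sets, and those with empty relative interior
  cannot fill a nonempty relatively open set, so the remaining ones still cover
  (\<open>finite_closed_cover_prune\<close>).

  With the maximum over the returned vertices identified as the recourse value, the criterion in the
  theorem says that \<open>Y \<Phi>\<close> is feasible with the optimal cost at each scenario.  The cost of such a
  policy coincides with the recourse value on \<open>\<Xi>\<close>, so both have the same worst-case expectation.
\<close>


section \<open>Finite closed covers\<close>

lemma finite_Union_closed_empty_interior:
  assumes "finite \<F>" "\<And>C. C \<in> \<F> \<Longrightarrow> closedin X C \<and> X interior_of C = {}"
  shows "X interior_of (\<Union>\<F>) = {}"
  using assms
  by (induction rule: finite_induct) (auto simp: interior_of_union_eq_empty)

text \<open>
  The part of the space missed by the members with nonempty interior is open and is contained in a
  finite union of closed sets with empty interior, so it is empty.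
\<close>

lemma finite_closed_cover_prune:
  assumes "finite \<F>" "\<And>C. C \<in> \<F> \<Longrightarrow> closedin X C" "topspace X \<subseteq> \<Union>\<F>"
  shows "topspace X \<subseteq> \<Union>{C \<in> \<F>. X interior_of C \<noteq> {}}"
proof -
  let ?U = "topspace X - \<Union>{C \<in> \<F>. X interior_of C \<noteq> {}}"
  let ?E = "{C \<in> \<F>. X interior_of C = {}}"
  have "closedin X (\<Union>{C \<in> \<F>. X interior_of C \<noteq> {}})"
    using assms by (intro closedin_Union) auto
  then have "openin X ?U"
    by (simp add: openin_diff)
  moreover have "?U \<subseteq> \<Union>?E"
    using assms(3) by blast
  ultimately have "?U \<subseteq> X interior_of (\<Union>?E)"
    by (simp add: interior_of_maximal)
  moreover have "X interior_of (\<Union>?E) = {}"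
    using assms by (intro finite_Union_closed_empty_interior) auto
  ultimately show ?thesis
    by blast
qed


section \<open>Vertices of the dual polyhedron\<close>

text \<open>
  Moving a vertex a little along \<open>r\<close> or \<open>-r\<close> keeps it in the dual polyhedron when \<open>r\<close> solves the
  homogeneous equations and vanishes wherever the vertex does.
\<close>

lemma vertex_kernel_trivial:
  fixes D :: "('x::finite, 'm::finite, 'n::finite, 'f::finite, 'p::finite, 't::finite, 'l::finite)
                two_stage"
  assumes s: "s \<in> vertices D" and r: "transpose (Cmat D) *v r = 0" and sub: "supp r \<subseteq> supp s"
  shows "r = 0"
proof (rule ccontr)
  assume "r \<noteq> 0"
  have ext: "s extreme_point_of dual_poly D"
    using s by (simp add: vertices_def)
  then have Cs: "transpose (Cmat D) *v s = bvec D" and s0: "\<And>i. 0 \<le> s $ i"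
    by (auto simp: extreme_point_of_def dual_poly_def less_eq_vec_def)
  \<comment> \<open>The ratio test; the added 1 keeps the denominators positive.\<close>
  define t where "t = Min (range (\<lambda>i. if i \<in> supp s then s $ i / (1 + \<bar>r $ i\<bar>) else 1))"
  have "t \<in> range (\<lambda>i. if i \<in> supp s then s $ i / (1 + \<bar>r $ i\<bar>) else 1)"
    unfolding t_def by (rule Min_in) auto
  then have t: "t > 0"
    using s0 by (auto simp: supp_def less_le split: if_splits intro!: divide_pos_pos)
  have tr: "t * \<bar>r $ i\<bar> \<le> s $ i" for i
  proof (cases "i \<in> supp s")
    case True
    have "t \<le> (if i \<in> supp s then s $ i / (1 + \<bar>r $ i\<bar>) else 1)"
      unfolding t_def by (rule Min_le) auto
    with True have "t * (1 + \<bar>r $ i\<bar>) \<le> s $ i"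
      by (simp add: pos_le_divide_eq)
    with t show ?thesis
      by (simp add: distrib_left)
  next
    case False
    with sub have "r $ i = 0"
      by (auto simp: supp_def)
    with s0 show ?thesis
      by simp
  qed
  have in_poly: "s + u *\<^sub>R r \<in> dual_poly D" if "\<bar>u\<bar> = t" for u
  proof -
    have "0 \<le> s $ i + u * r $ i" for i
    proof -
      have "\<bar>u * r $ i\<bar> \<le> s $ i"
        using tr[of i] that by (simp add: abs_mult)
      then show ?thesis
        by linarith
    qed
    then show ?thesis
      using Cs r by (simp add: dual_poly_def less_eq_vec_def vector_matrix_left_distrib
          scaleR_vector_matrix_assoc)
  qed
  have "s = midpoint (s + t *\<^sub>R r) (s + (- t) *\<^sub>R r)"
    by (simp add: midpoint_def flip: scaleR_2)
  moreover have "s + t *\<^sub>R r \<noteq> s + (- t) *\<^sub>R r"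
    using t \<open>r \<noteq> 0\<close> by (metis add_left_cancel neg_0_less_iff_less order_less_asym scaleR_right_imp_eq)
  ultimately have "s \<in> open_segment (s + t *\<^sub>R r) (s + (- t) *\<^sub>R r)"
    by (metis midpoint_in_open_segment)
  moreover have "s + t *\<^sub>R r \<in> dual_poly D" "s + (- t) *\<^sub>R r \<in> dual_poly D"
    using t by (auto intro!: in_poly simp del: scaleR_minus_left)
  ultimately show False
    using ext unfolding extreme_point_of_def by blast
qed

text \<open>
  The difference of two vertices with the same support solves the homogeneous equations, so a vertex
  is determined by its support.
\<close>

lemma finite_vertices:
  fixes D :: "('x::finite, 'm::finite, 'n::finite, 'f::finite, 'p::finite, 't::finite, 'l::finite)
                two_stage"
  shows "finite (vertices D)"
proof -
  have "inj_on supp (vertices D)"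
  proof (rule inj_onI)
    fix s s' assume s: "s \<in> vertices D" "s' \<in> vertices D" and eq: "supp s = supp s'"
    have "transpose (Cmat D) *v (s - s') = 0"
      using s by (simp add: vertices_def extreme_point_of_def dual_poly_def
          vector_matrix_mult_diff_distrib)
    moreover have "supp (s - s') \<subseteq> supp s \<union> supp s'"
      by (auto simp: supp_def)
    ultimately have "s - s' = 0"
      using vertex_kernel_trivial[OF s(1)] eq by blast
    then show "s = s'"
      by simp
  qed
  then show ?thesis
    by (rule inj_on_finite[of _ _ UNIV]) auto
qed

lemma bij_betw_enum_of:
  fixes J :: "'m::finite set"
  assumes "card J = CARD('n::finite)"
  shows "bij_betw (enum_of J :: 'n \<Rightarrow> 'm) UNIV J"
proof -
  have "\<exists>e. bij_betw e (UNIV :: 'n set) J"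
    using assms by (intro finite_same_card_bij) simp_all
  then show ?thesis
    unfolding enum_of_def by (rule someI_ex)
qed

text \<open>
  A linear dependence among the rows, padded by zeros outside the support, is a vector as in
  \<open>vertex_kernel_trivial\<close>.
\<close>

lemma invertible_sub_rows_vertex:
  fixes D :: "('x::finite, 'm::finite, 'n::finite, 'f::finite, 'p::finite, 't::finite, 'l::finite)
                two_stage"
  assumes s: "s \<in> vertices D" and card: "card (supp s) = CARD('n)"
  shows "invertible (sub_rows (supp s) (Cmat D))"
proof -
  let ?e = "enum_of (supp s) :: 'n \<Rightarrow> 'm"
  have bij: "bij_betw ?e UNIV (supp s)"
    using card by (rule bij_betw_enum_of)
  have "v = 0" if v: "transpose (sub_rows (supp s) (Cmat D)) *v v = 0" for v
  proof -
    define r where "r = (\<chi> k. if k \<in> supp s then v $ inv_into UNIV ?e k else 0)"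
    have re: "r $ ?e i = v $ i" for i
      using bij bij_betwE[OF bij] by (auto simp: r_def bij_betw_def)
    have "transpose (Cmat D) *v r = 0"
    proof (rule vec_eq_iff[THEN iffD2], rule allI)
      fix j
      have "(transpose (Cmat D) *v r) $ j = (\<Sum>k\<in>UNIV. Cmat D $ k $ j * r $ k)"
        by (simp add: matrix_vector_mult_def transpose_def)
      also have "\<dots> = (\<Sum>k\<in>supp s. Cmat D $ k $ j * r $ k)"
        by (rule sum.mono_neutral_right) (auto simp: r_def)
      also have "\<dots> = (\<Sum>i\<in>UNIV. Cmat D $ ?e i $ j * v $ i)"
        by (simp add: sum.reindex_bij_betw[OF bij, symmetric] re)
      also have "\<dots> = (transpose (sub_rows (supp s) (Cmat D)) *v v) $ j"
        by (simp add: matrix_vector_mult_def transpose_def sub_rows_def)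
      finally show "(transpose (Cmat D) *v r) $ j = 0 $ j"
        using v by simp
    qed
    moreover have "supp r \<subseteq> supp s"
      by (auto simp: r_def supp_def)
    ultimately have "r = 0"
      using vertex_kernel_trivial[OF s] by blast
    then show ?thesis
      using re by (metis vec_eq_iff zero_index)
  qed
  then have "invertible (transpose (sub_rows (supp s) (Cmat D)))"
    by (simp add: invertible_left_inverse matrix_left_invertible_ker)
  then show ?thesis
    using transpose_invertible by fastforce
qed

lemma basic_rule_tight:
  fixes D :: "('x::finite, 'm::finite, 'n::finite, 'f::finite, 'p::finite, 't::finite, 'l::finite)
                two_stage"
  assumes s: "s \<in> vertices D" and card: "card (supp s) = CARD('n)" and k: "k \<in> supp s"
  shows "(Cmat D *v basic_rule D x1 s \<xi>) $ k = dvec D x1 \<xi> $ k"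
proof -
  let ?A = "sub_rows (supp s) (Cmat D) :: real ^ 'n ^ 'n"
  obtain i :: 'n where i: "k = enum_of (supp s) i"
    using bij_betw_enum_of[OF card] k by (auto simp: bij_betw_def)
  have "?A ** matrix_inv ?A = mat 1 \<and> matrix_inv ?A ** ?A = mat 1"
    using invertible_sub_rows_vertex[OF s card] unfolding invertible_def matrix_inv_def
    by (rule someI_ex)
  then have "?A *v basic_rule D x1 s \<xi> = sub_vec (supp s) (dvec D x1 \<xi>)"
    by (simp add: basic_rule_def matrix_vector_mul_assoc)
  then have "(?A *v basic_rule D x1 s \<xi>) $ i = dvec D x1 \<xi> $ k"
    by (simp add: sub_vec_def i)
  then show ?thesis
    by (simp add: matrix_vector_mul_component sub_rows_def i)
qed


section \<open>Duality of the recourse problem\<close>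

lemma dual_poly_cost:
  assumes "z \<in> dual_poly D"
  shows "bvec D \<bullet> y = z \<bullet> (Cmat D *v y)"
proof -
  have "z v* Cmat D = bvec D"
    using assms by (simp add: dual_poly_def)
  then show ?thesis
    by (metis dot_lmul_matrix)
qed

lemma weak_duality:
  assumes z: "z \<in> dual_poly D" and y: "recourse_feasible D x1 \<xi> y"
  shows "dvec D x1 \<xi> \<bullet> z \<le> bvec D \<bullet> y"
proof -
  have "dvec D x1 \<xi> \<bullet> z \<le> (Cmat D *v y) \<bullet> z"
    unfolding inner_vec_def inner_real_def using z y
    by (intro sum_mono mult_right_mono)
      (simp_all add: dual_poly_def recourse_feasible_def less_eq_vec_def)
  then show ?thesis
    by (simp only: dual_poly_cost[OF z] inner_commute[of z])
qed

lemma psi_eqI: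
  assumes "z \<in> dual_poly D" "recourse_feasible D x1 \<xi> y" "bvec D \<bullet> y = dvec D x1 \<xi> \<bullet> z"
  shows "psi D x1 \<xi> = ereal (dvec D x1 \<xi> \<bullet> z)"
  unfolding psi_def
proof (rule antisym)
  show "(INF x2\<in>{x2. recourse_feasible D x1 \<xi> x2}. ereal (bvec D \<bullet> x2)) \<le> ereal (dvec D x1 \<xi> \<bullet> z)"
    using assms by (intro INF_lower2[of y]) auto
  show "ereal (dvec D x1 \<xi> \<bullet> z) \<le> (INF x2\<in>{x2. recourse_feasible D x1 \<xi> x2}. ereal (bvec D \<bullet> x2))"
    using assms weak_duality by (intro INF_greatest) fastforce
qed

lemma recourse_optimal_iff_psi:
  "recourse_optimal D x1 \<xi> y \<longleftrightarrow>
     recourse_feasible D x1 \<xi> y \<and> ereal (bvec D \<bullet> y) = psi D x1 \<xi>"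
proof
  assume "recourse_optimal D x1 \<xi> y"
  then have f: "recourse_feasible D x1 \<xi> y"
    and min: "\<And>y'. recourse_feasible D x1 \<xi> y' \<Longrightarrow> bvec D \<bullet> y \<le> bvec D \<bullet> y'"
    by (auto simp: recourse_optimal_def is_arg_min_linorder)
  have "psi D x1 \<xi> = ereal (bvec D \<bullet> y)"
    unfolding psi_def using f min by (intro INF_eqI) auto
  with f show "recourse_feasible D x1 \<xi> y \<and> ereal (bvec D \<bullet> y) = psi D x1 \<xi>"
    by simp
next
  assume y: "recourse_feasible D x1 \<xi> y \<and> ereal (bvec D \<bullet> y) = psi D x1 \<xi>"
  have "bvec D \<bullet> y \<le> bvec D \<bullet> y'" if "recourse_feasible D x1 \<xi> y'" for y'
  proof -
    have "psi D x1 \<xi> \<le> ereal (bvec D \<bullet> y')"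
      unfolding psi_def using that by (intro INF_lower) auto
    with y show ?thesis
      by (metis ereal_less_eq(3))
  qed
  with y show "recourse_optimal D x1 \<xi> y"
    by (auto simp: recourse_optimal_def is_arg_min_linorder)
qed


section \<open>Dominance cells and audits\<close>

lemma continuous_on_dvec [continuous_intros]:
  "continuous_on A (dvec D x1)"
  unfolding dvec_def
  by (intro continuous_intros linear_continuous_on matrix_vector_mul_bounded_linear)

lemma closedin_cell:
  fixes D :: "('x::finite, 'm::finite, 'n::finite, 'f::finite, 'p::finite, 't::finite, 'l::finite)
                two_stage"
  shows "closedin (top_of_set (Xi D)) (cell D x1 T s)"
proof -
  have "cell D x1 T s = Xi D \<inter> (\<Inter>s'\<in>T. {\<xi>. dvec D x1 \<xi> \<bullet> s' \<le> dvec D x1 \<xi> \<bullet> s})"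
    by (auto simp: cell_def)
  moreover have "closed (\<Inter>s'\<in>T. {\<xi>. dvec D x1 \<xi> \<bullet> s' \<le> dvec D x1 \<xi> \<bullet> s})"
    by (intro closed_INT ballI closed_Collect_le continuous_intros)
  ultimately show ?thesis
    by (simp add: closedin_closed_Int)
qed

lemma continuous_on_violation: "continuous_on A (violation D x1 s k)"
proof -
  have sub: "continuous_on A (\<lambda>\<xi>. sub_vec J (dvec D x1 \<xi>))" for J
    unfolding sub_vec_def by (intro continuous_intros)
  have "continuous_on A (\<lambda>\<xi>. M *v sub_vec J (dvec D x1 \<xi>))" for J and M :: "real ^ 'n ^ 'j"
    by (rule continuous_on_compose2[OF linear_continuous_on[OF matrix_vector_mul_bounded_linear] sub])
      auto
  then show ?thesis
    unfolding violation_def basic_rule_def matrix_vector_mul_assoc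
    by (intro continuous_intros)
qed

text \<open>
  A conditional supremum of reals bounds its members only when these are bounded above, which
  compactness of \<open>\<Xi>\<close> supplies.
\<close>

lemma violation_le_audit:
  assumes "compact (Xi D)" "\<xi> \<in> cell D x1 T s"
  shows "violation D x1 s k \<xi> \<le> audit D x1 T s k"
proof -
  have "compact (cell D x1 T s)"
    using assms(1) closedin_cell closedin_compact by blast
  then have "bdd_above (violation D x1 s k ` cell D x1 T s)"
    by (intro bounded_imp_bdd_above compact_imp_bounded compact_continuous_image
        continuous_on_violation)
  then show ?thesis
    unfolding audit_def using assms(2) by (rule cSUP_upper2) simp
qed

text \<open>
  The basic rule is complementary to \<open>s\<close>, so its cost is the dual value of \<open>s\<close>; with nonpositive
  audits it is primal feasible on the cell.
\<close>

lemma psi_on_audited_cell: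
  fixes D :: "('x::finite, 'm::finite, 'n::finite, 'f::finite, 'p::finite, 't::finite, 'l::finite)
                two_stage"
  assumes "compact (Xi D)"
    and s: "s \<in> vertices D" "s \<in> T" and card: "card (supp s) = CARD('n)"
    and audits: "\<And>k. audit_pair D x1 T s k \<Longrightarrow> audit D x1 T s k \<le> 0"
    and \<xi>: "\<xi> \<in> cell D x1 T s"
  shows "psi D x1 \<xi> = ereal (dvec D x1 \<xi> \<bullet> s)"
proof (rule psi_eqI)
  let ?y = "basic_rule D x1 s \<xi>"
  show z: "s \<in> dual_poly D"
    using s by (simp add: vertices_def extreme_point_of_def)
  have "dvec D x1 \<xi> $ k \<le> (Cmat D *v ?y) $ k" for k
  proof (cases "k \<in> supp s")
    case True
    then show ?thesis
      using basic_rule_tight[OF s(1) card] by simp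
  next
    case False
    then have "audit D x1 T s k \<le> 0"
      using \<xi> s(2) by (intro audits) (auto simp: audit_pair_def)
    then have "violation D x1 s k \<xi> \<le> 0"
      using violation_le_audit[OF assms(1) \<xi>] order_trans by blast
    then show ?thesis
      by (simp add: violation_def)
  qed
  then show "recourse_feasible D x1 \<xi> ?y"
    by (simp add: recourse_feasible_def less_eq_vec_def)
  have "s $ k * (Cmat D *v ?y) $ k = s $ k * dvec D x1 \<xi> $ k" for k
    using basic_rule_tight[OF s(1) card] by (cases "k \<in> supp s") (auto simp: supp_def)
  then have "s \<bullet> (Cmat D *v ?y) = s \<bullet> dvec D x1 \<xi>"
    by (simp only: inner_vec_def inner_real_def)
  then show "bvec D \<bullet> ?y = dvec D x1 \<xi> \<bullet> s"
    by (simp only: dual_poly_cost[OF z] inner_commute[of s])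
qed

lemma cells_cover:
  assumes "finite T" "T \<noteq> {}" "\<xi> \<in> Xi D"
  shows "\<exists>s\<in>T. \<xi> \<in> cell D x1 T s"
proof -
  have "Max ((\<lambda>s. dvec D x1 \<xi> \<bullet> s) ` T) \<in> (\<lambda>s. dvec D x1 \<xi> \<bullet> s) ` T"
    using assms by (intro Max_in) auto
  then obtain s where s: "s \<in> T" "Max ((\<lambda>s. dvec D x1 \<xi> \<bullet> s) ` T) = dvec D x1 \<xi> \<bullet> s"
    by auto
  have "dvec D x1 \<xi> \<bullet> s' \<le> dvec D x1 \<xi> \<bullet> s" if "s' \<in> T" for s'
    using assms(1) that unfolding s(2)[symmetric] by (intro Max_ge) auto
  with s(1) assms(3) show ?thesis
    by (auto simp: cell_def)
qed

text \<open>
  Every scenario lies in the cell of a vertex that survives the pruning, and there that vertex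
  attains the recourse value.
\<close>

lemma audited_vertices_attain_psi:
  fixes D :: "('x::finite, 'm::finite, 'n::finite, 'f::finite, 'p::finite, 't::finite, 'l::finite)
                two_stage"
  assumes "compact (Xi D)"
    and T: "T \<subseteq> vertices D" "T \<noteq> {}" and card: "\<And>s. s \<in> T \<Longrightarrow> card (supp s) = CARD('n)"
    and audits: "\<And>s k. audit_pair D x1 T s k \<Longrightarrow> audit D x1 T s k \<le> 0"
    and Sval: "Sval = {s\<in>T. top_of_set (Xi D) interior_of cell D x1 T s \<noteq> {}}"
    and \<xi>: "\<xi> \<in> Xi D"
  shows "ereal (Max ((\<lambda>s. dvec D x1 \<xi> \<bullet> s) ` Sval)) = psi D x1 \<xi>"
proof -
  let ?X = "top_of_set (Xi D)"
  have fin: "finite T"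
    using T finite_vertices finite_subset by blast
  have "topspace ?X \<subseteq> \<Union>{C \<in> cell D x1 T ` T. ?X interior_of C \<noteq> {}}"
    using fin cells_cover[OF fin T(2)] by (intro finite_closed_cover_prune) (auto simp: closedin_cell)
  moreover have "\<xi> \<in> topspace ?X"
    using \<xi> by simp
  ultimately obtain s where s: "s \<in> Sval" "\<xi> \<in> cell D x1 T s"
    unfolding Sval by blast
  then have "Max ((\<lambda>s. dvec D x1 \<xi> \<bullet> s) ` Sval) = dvec D x1 \<xi> \<bullet> s"
    using fin by (intro Max_eqI) (auto simp: Sval cell_def)
  moreover have "psi D x1 \<xi> = ereal (dvec D x1 \<xi> \<bullet> s)"
    using s T card audits by (intro psi_on_audited_cell[of D s T] assms(1)) (auto simp: Sval)
  ultimately show ?thesis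
    by simp
qed


section \<open>What the algorithms return\<close>

lemma separation_vertex: "separation D \<Xi>' v V s \<Longrightarrow> s \<in> vertices D"
  by (cases v) (simp add: separation_def)

lemma epgo_reaches_subset_vertices:
  "epgo_reaches D S1 \<epsilon>disc \<epsilon>obj T \<Longrightarrow> T \<subseteq> vertices D"
  by (induction rule: epgo_reaches.induct) (simp_all add: separation_vertex)

lemma epgo_output_set_subset_vertices:
  assumes "epgo_output_set D S'"
  shows "S' \<subseteq> vertices D"
proof -
  obtain S1 \<epsilon>disc \<epsilon>obj T where "epgo_reaches D S1 \<epsilon>disc \<epsilon>obj T" and del: "(delete_vertex D)\<^sup>*\<^sup>* T S'"
    using assms unfolding epgo_output_set_def epgo_returns_def by blast
  then have "T \<subseteq> vertices D"
    by (simp add: epgo_reaches_subset_vertices)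
  moreover have "S' \<subseteq> T"
    using del by (induction rule: rtranclp_induct) (auto simp: delete_vertex_def)
  ultimately show ?thesis
    by blast
qed

lemma epgv_reaches_superset:
  "epgv_reaches D x1 S' \<epsilon>aud T \<Longrightarrow> S' \<subseteq> vertices D \<Longrightarrow> S' \<subseteq> T \<and> T \<subseteq> vertices D"
  by (induction rule: epgv_reaches.induct) auto

text \<open>
  A nonpositive separation value makes the restricted solution satisfy every constraint of the full
  master problem.  That problem has fewer feasible points than the restricted one, so optimality
  carries over.
\<close>

lemma epgo_certified_master_optimal:
  assumes "epgo_certified D x1"
  shows "\<exists>\<theta>. master_optimal D (vertices D) (x1, \<theta>)"
proof -
  obtain T \<theta> V s S1 \<epsilon>disc where T: "T \<subseteq> vertices D" and opt: "master_optimal D T (x1, \<theta>)"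
    and sep: "separation D (Xi D) (x1, \<theta>) V s" and V: "V \<le> 0"
    using assms epgo_reaches_subset_vertices
    unfolding epgo_certified_def epgo_returns_def by blast
  have "dvec D x1 \<xi> \<bullet> z \<le> phi D l \<theta> \<xi>" if "\<xi> \<in> Xi D" "z \<in> vertices D" for \<xi> z l
  proof -
    have "z \<in> dual_poly D"
      using that by (simp add: vertices_def extreme_point_of_def)
    then have "dvec D x1 \<xi> \<bullet> z - phi D l \<theta> \<xi> \<le> V"
      using sep that by (auto simp: separation_def)
    with V show ?thesis
      by simp
  qed
  then have "master_feasible D (vertices D) (x1, \<theta>)"
    using opt by (auto simp: master_optimal_def is_arg_min_def master_feasible_def)
  moreover have "master_feasible D T v" if "master_feasible D (vertices D) v" for v
    using that T by (auto simp: master_feasible_def split: prod.splits)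
  ultimately have "master_optimal D (vertices D) (x1, \<theta>)"
    using opt by (auto simp: master_optimal_def is_arg_min_def)
  then show ?thesis
    by blast
qed

lemma epgv_returns_psi:
  fixes D :: "('x::finite, 'm::finite, 'n::finite, 'f::finite, 'p::finite, 't::finite, 'l::finite)
                two_stage"
  assumes "compact (Xi D)" "\<forall>s\<in>vertices D. card (supp s) = CARD('n)"
    and ret: "epgv_returns D x1 S' 0 Sval" and "\<xi> \<in> Xi D"
  shows "ereal (Max ((\<lambda>s. dvec D x1 \<xi> \<bullet> s) ` Sval)) = psi D x1 \<xi>"
proof -
  obtain T where S': "S' \<noteq> {}" "epgo_output_set D S'" and T: "epgv_reaches D x1 S' 0 T"
    and audits: "\<And>s k. audit_pair D x1 T s k \<Longrightarrow> audit D x1 T s k \<le> 0"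
    and Sval: "Sval = {s\<in>T. top_of_set (Xi D) interior_of cell D x1 T s \<noteq> {}}"
    using ret unfolding epgv_returns_def by blast
  have "S' \<subseteq> T" "T \<subseteq> vertices D"
    using epgv_reaches_superset[OF T epgo_output_set_subset_vertices[OF S'(2)]] by auto
  with S' assms Sval audits show ?thesis
    by (intro audited_vertices_attain_psi[where T = T]) auto
qed


section \<open>Exactness of lifted policies\<close>

lemma worst_case_cong:
  assumes "\<And>\<xi>. \<xi> \<in> Xi D \<Longrightarrow> g \<xi> = h \<xi>"
  shows "worst_case D g = worst_case D h"
proof -
  have "(\<lambda>\<xi>. e2ennreal (g \<xi>) * indicator (Xi D) \<xi>) = (\<lambda>\<xi>. e2ennreal (h \<xi>) * indicator (Xi D) \<xi>)"
    "(\<lambda>\<xi>. e2ennreal (- g \<xi>) * indicator (Xi D) \<xi>) = (\<lambda>\<xi>. e2ennreal (- h \<xi>) * indicator (Xi D) \<xi>)"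
    using assms by (auto simp: fun_eq_iff indicator_def)
  then show ?thesis
    by (simp add: worst_case_def expect_def)
qed

theorem proposition4:
  fixes D :: "('x::finite, 'm::finite, 'n::finite, 'f::finite, 'p::finite, 't::finite, 'l::finite)
                two_stage"
    and \<Phi> :: "real ^ 'x \<Rightarrow> real ^ 'k::finite"
    and x1 :: "real ^ 'f"
    and S' Sval :: "(real ^ 'm) set"
  assumes "standing_assumptions D"
    and "rank (Cmat D) = CARD('n)"
    and "\<forall>s\<in>vertices D. card (supp s) = CARD('n)"
    and "epgo_certified D x1"
    and "epgv_returns D x1 S' 0 Sval"
  shows "(\<forall>\<xi>\<in>Xi D. ereal (Max ((\<lambda>s. dvec D x1 \<xi> \<bullet> s) ` Sval)) = psi D x1 \<xi>) \<and>
    ((\<exists>\<pi>\<in>lifted_policies \<Phi>. \<forall>\<xi>\<in>Xi D. recourse_optimal D x1 \<xi> (\<pi> \<xi>)) \<longleftrightarrow>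
     (\<exists>Y::real ^ 'k ^ 'n. \<forall>\<xi>\<in>Xi D.
        Cmat D *v (Y *v \<Phi> \<xi>) \<ge> dvec D x1 \<xi> \<and>
        bvec D \<bullet> (Y *v \<Phi> \<xi>) = Max ((\<lambda>s. dvec D x1 \<xi> \<bullet> s) ` Sval))) \<and>
    (\<forall>Y::real ^ 'k ^ 'n.
       (\<forall>\<xi>\<in>Xi D.
          Cmat D *v (Y *v \<Phi> \<xi>) \<ge> dvec D x1 \<xi> \<and>
          bvec D \<bullet> (Y *v \<Phi> \<xi>) = Max ((\<lambda>s. dvec D x1 \<xi> \<bullet> s) ` Sval)) \<longrightarrow>
       x1 \<in> X1 D \<and>
       (\<exists>\<theta>. master_optimal D (vertices D) (x1, \<theta>)) \<and>
       (\<forall>\<xi>\<in>Xi D. recourse_feasible D x1 \<xi> (Y *v \<Phi> \<xi>)) \<and>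
       ereal (cvec D \<bullet> x1) + worst_case D (\<lambda>\<xi>. ereal (bvec D \<bullet> (Y *v \<Phi> \<xi>)))
         = master_value D (vertices D))"
proof -
  let ?M = "\<lambda>\<xi>. Max ((\<lambda>s. dvec D x1 \<xi> \<bullet> s) ` Sval)"
  have M: "ereal (?M \<xi>) = psi D x1 \<xi>" if "\<xi> \<in> Xi D" for \<xi>
    using assms that by (intro epgv_returns_psi) (auto simp: standing_assumptions_def)
  have opt: "recourse_optimal D x1 \<xi> y \<longleftrightarrow> Cmat D *v y \<ge> dvec D x1 \<xi> \<and> bvec D \<bullet> y = ?M \<xi>"
    if "\<xi> \<in> Xi D" for \<xi> y
    by (simp add: recourse_optimal_iff_psi recourse_feasible_def flip: M[OF that])
  obtain \<theta> where \<theta>: "master_optimal D (vertices D) (x1, \<theta>)"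
    using epgo_certified_master_optimal assms(4) by blast
  then have X1: "x1 \<in> X1 D"
    by (auto simp: master_optimal_def is_arg_min_def master_feasible_def)
  have cost: "ereal (cvec D \<bullet> x1) + worst_case D (\<lambda>\<xi>. ereal (bvec D \<bullet> (Y *v \<Phi> \<xi>)))
      = master_value D (vertices D)"
    if Y: "\<forall>\<xi>\<in>Xi D. bvec D \<bullet> (Y *v \<Phi> \<xi>) = ?M \<xi>" for Y :: "real ^ 'k ^ 'n"
  proof -
    have "worst_case D (\<lambda>\<xi>. ereal (bvec D \<bullet> (Y *v \<Phi> \<xi>))) = worst_case D (psi D x1)"
      using Y M by (intro worst_case_cong) simp
    moreover have "dro_optimal D x1" "master_value D (vertices D) = dro_value D"
      using assms(1) \<theta> unfolding standing_assumptions_def by blast+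
    ultimately show ?thesis
      by (simp add: dro_optimal_def dro_objective_def)
  qed
  show ?thesis
  proof (intro conjI)
    show "\<forall>\<xi>\<in>Xi D. ereal (?M \<xi>) = psi D x1 \<xi>"
      using M by blast
    show "(\<exists>\<pi>\<in>lifted_policies \<Phi>. \<forall>\<xi>\<in>Xi D. recourse_optimal D x1 \<xi> (\<pi> \<xi>)) \<longleftrightarrow>
      (\<exists>Y::real ^ 'k ^ 'n. \<forall>\<xi>\<in>Xi D.
        Cmat D *v (Y *v \<Phi> \<xi>) \<ge> dvec D x1 \<xi> \<and> bvec D \<bullet> (Y *v \<Phi> \<xi>) = ?M \<xi>)"
      using opt by (auto simp: lifted_policies_def)
    show "\<forall>Y::real ^ 'k ^ 'n.
       (\<forall>\<xi>\<in>Xi D. Cmat D *v (Y *v \<Phi> \<xi>) \<ge> dvec D x1 \<xi> \<and> bvec D \<bullet> (Y *v \<Phi> \<xi>) = ?M \<xi>) \<longrightarrow>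
       x1 \<in> X1 D \<and> (\<exists>\<theta>. master_optimal D (vertices D) (x1, \<theta>)) \<and>
       (\<forall>\<xi>\<in>Xi D. recourse_feasible D x1 \<xi> (Y *v \<Phi> \<xi>)) \<and>
       ereal (cvec D \<bullet> x1) + worst_case D (\<lambda>\<xi>. ereal (bvec D \<bullet> (Y *v \<Phi> \<xi>)))
         = master_value D (vertices D)"
      using X1 \<theta> cost by (auto simp: recourse_feasible_def)
  qed
qed

end
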